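(* Let $n$ be a positive integer with $n\equiv 1\pmod 4$. Then, modulo $\Phi_n(q)$, \[ \sum_{k=0}^{(n-1)/2}\frac{(q;q^2)_k^2(q^2;q^4)_k}{(q^2;q^2)_k^2(q^4;q^4)_k}\,(-q)^k \equiv\begin{cases} \dfrac{(q,q^2;q^4)_{(n-1)/8}^2\,(-q;q)_{(n-1)/2}}{(q^4;q^4)_{(n-1)/4}^2}\,q^{-(1-n)^2/4} &\text{if } n\equiv 1\pmod 8,\\[8pt] 0 &\text{if } n\equiv 5\pmod 8. \end{cases} \]
   Context: For an indeterminate $a$ and a nonnegative integer $k$, $(a;q)_k=\prod_{j=0}^{k-1}(1-aq^j)$, with $(a;q)_0=1$, and $(a_1,\dots,a_m;q)_k=(a_1;q)_k\cdots(a_m;q)_k$. $\Phi_n(q)=\prod_{1\le j\le n,\ \gcd(j,n)=1}(q-e^{2\pi i j/n})$ is the $n$-th cyclotomic polynomial. A congruence between rational functions in $q$ (possibly involving negative powers of $q$) modulo a polynomial $P(q)$ means that the difference, written as a ratio of polynomials with denominator coprime to $P(q)$, has numerator divisible by $P(q)$. *)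

theory Defs
  imports Complex_Main "HOL-Computational_Algebra.Polynomial" "HOL-Computational_Algebra.Fraction_Field"
begin

type_synonym ratfun = "complex poly fract"

definition qvar :: ratfun where
  "qvar = Fract [:0, 1:] 1"

definition qpoch :: "'a::comm_ring_1 \<Rightarrow> 'a \<Rightarrow> nat \<Rightarrow> 'a" where
  "qpoch a x k = (\<Prod>j<k. 1 - a * x ^ j)"

definition cyclo :: "nat \<Rightarrow> complex poly" where
  "cyclo n = (\<Prod>j\<in>{j. 1 \<le> j \<and> j \<le> n \<and> coprime j n}.
                 [:- cis (2 * pi * real j / real n), 1:])"

definition ratfun_cong :: "ratfun \<Rightarrow> ratfun \<Rightarrow> complex poly \<Rightarrow> bool" where
  "ratfun_cong x y P \<longleftrightarrow>
     (\<exists>a b. b \<noteq> 0 \<and> coprime b P \<and> P dvd a \<and> x - y = Fract a b)"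

end

theory Submission
  imports Defs "HOL-Computational_Algebra.Fundamental_Theorem_Algebra"
begin

text \<open>
  Modulo the cyclotomic polynomial it suffices to compare values at each primitive \<open>n\<close>-th root of
  unity \<open>q\<close>. Write \<open>n = 4 M + 1\<close>, \<open>a\<^sub>k = (q;q^4)\<^sub>k / (q^4;q^4)\<^sub>k\<close> and \<open>F(z) = \<Sum>k. a\<^sub>k\<^sup>2 z^k\<close>. By a
  special case of Jackson's product formula (a \<open>q\<close>-analogue of Clausen's formula) the
  generating function of the summands without the factor \<open>(-q)^k\<close> is \<open>F(z) F(q\<^sup>2 z)\<close>. At \<open>q\<close> the
  series \<open>F\<close> terminates after \<open>k = M\<close>, so the sum is exactly \<open>F(-q) F(-q^3)\<close>.
  As \<open>q = (q^4)^(-M)\<close>, the \<open>a\<^sub>k\<close> are the coefficients of \<open>(x q;q^4)\<^sub>M\<close>, and they satisfy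
  \<open>a\<^sub>M\<^sub>-\<^sub>k = a\<^sub>M q^(3k) a\<^sub>k\<close>. So \<open>a\<^sub>M F(-q^3)\<close> and \<open>a\<^sub>M F(-q)\<close> are the coefficients of \<open>x^M\<close> in
  \<open>(x q, -x q;q^4)\<^sub>M = (x\<^sup>2 q\<^sup>2;q^8)\<^sub>M\<close> and in \<open>(x q, -x/q;q^4)\<^sub>M = (-x/q;-q\<^sup>2)\<^sub>2\<^sub>M\<close>. The first
  one vanishes for odd \<open>M\<close>; otherwise both are products by the \<open>q\<close>-binomial theorem.
\<close>

section \<open>Elementary rules for q-Pochhammer symbols\<close>

lemma qpoch_0 [simp]: "qpoch a x 0 = 1"
  by (simp add: qpoch_def)

lemma qpoch_Suc [simp]: "qpoch a x (Suc k) = qpoch a x k * (1 - a * x ^ k)"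
  by (simp add: qpoch_def)

lemma qpoch_add: "qpoch a x (m + k) = qpoch a x m * qpoch (a * x ^ m) x k"
  by (induction k) (simp_all add: power_add mult_ac)

lemma qpoch_mult_minus: "qpoch a x k * qpoch (- a) x k = qpoch (a\<^sup>2) (x\<^sup>2) k"
proof (induction k)
  case (Suc k)
  have "(1 - a * x ^ k) * (1 + a * x ^ k) = 1 - a\<^sup>2 * (x\<^sup>2) ^ k"
    by (simp add: algebra_simps power2_eq_square power_mult_distrib)
  with Suc show ?case
    by (simp add: mult_ac) (metis mult.assoc)
qed simp

lemma qpoch_double: "qpoch a x (2 * k) = qpoch a (x\<^sup>2) k * qpoch (a * x) (x\<^sup>2) k"
  by (induction k) (simp_all add: power_mult [symmetric] mult_ac)

lemma qpoch_nonzero: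
  fixes a x :: "'a::idom"
  assumes "\<And>j. j < k \<Longrightarrow> a * x ^ j \<noteq> 1"
  shows "qpoch a x k \<noteq> 0"
  using assms by (auto simp: qpoch_def)

lemma qpoch_base_nonzero:
  fixes x :: "'a::idom"
  assumes "\<And>i. 0 < i \<Longrightarrow> i \<le> k \<Longrightarrow> x ^ i \<noteq> 1"
  shows "qpoch x x k \<noteq> 0"
  using assms[of "Suc _"] by (intro qpoch_nonzero) auto

text \<open>
  The Wilf--Zeilberger certificate for the convolution identity below, with \<open>x = q^(2j)\<close> and
  \<open>y = q^(2(k-j))\<close>.
\<close>

lemma jackson_certificate:
  fixes q x y :: "'a::comm_ring_1"
  shows "((1 - q^2*x*y)^2 * (1 - q^4*x^2*y^2) * ((1 - q*y^2)^2 * (x + q^2*y)))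
      - ((1 - q*x*y)^2 * (1 - q^2*x^2*y^2) * ((1 - q^4*y^2)^2 * (x + y)))
    = (1 - q^4*y^2)^2 * (1 - q*x^2)^2 * (q^2*x*y^4 - y)
      - (1 - q*y^2)^2 * (1 - x^2)^2 * (q^8*x*y^4 - q^2*y)"
  by (simp add: power2_eq_square power4_eq_xxxx numeral_eq_Suc algebra_simps)

text \<open>
  Here \<open>a = x^(-N)\<close>, and comparing the product at \<open>x t\<close> and \<open>t\<close> gives a first-order recurrence
  for its coefficients.
\<close>

lemma coeff_qbinomial:
  fixes a c x :: "'a::field"
  assumes ax: "a * x ^ N = 1" and x: "\<And>i. 0 < i \<Longrightarrow> i \<le> k \<Longrightarrow> x ^ i \<noteq> 1"
  shows "coeff (\<Prod>j<N. [:1, - (c * (a * x ^ j)):]) k = c ^ k * (qpoch a x k / qpoch x x k)"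
proof -
  define p where "p = (\<Prod>j<N. [:1, - (c * (a * x ^ j)):])"
  have "[:1, - (c * a):] * pcompose p [:0, x:] = (\<Prod>j<Suc N. [:1, - (c * (a * x ^ j)):])"
    unfolding prod.lessThan_Suc_shift p_def pcompose_prod
    by (simp add: pcompose_pCons o_def mult_ac)
  \<comment> \<open>By \<open>ax\<close> the last factor of the longer product, at index
    \<open>N\<close>, is \<open>[:1, - c:]\<close>.\<close>
  also have "\<dots> = p * [:1, - c:]"
    by (simp add: p_def ax)
  finally have eq: "[:1, - (c * a):] * pcompose p [:0, x:] = p * [:1, - c:]" .
  have rec: "coeff p (Suc i) * (1 - x ^ Suc i) = c * coeff p i * (1 - a * x ^ i)" for i
  proof -
    have "coeff ([:1, - (c * a):] * pcompose p [:0, x:]) (Suc i) = coeff (p * [:1, - c:]) (Suc i)"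
      by (simp only: eq)
    then show ?thesis
      by (simp add: coeff_pcompose_linear algebra_simps)
  qed
  have "coeff p 0 = 1"
    by (simp add: p_def flip: poly_0_coeff_0) (simp add: poly_prod)
  from x have "coeff p k = c ^ k * (qpoch a x k / qpoch x x k)"
  proof (induction k)
    case (Suc k)
    have "qpoch x x (Suc k) \<noteq> 0" "1 - x ^ Suc k \<noteq> 0"
      using Suc.prems[of "Suc k"] by (simp_all add: qpoch_base_nonzero Suc.prems del: qpoch_Suc)
    with Suc.IH Suc.prems rec[of k] show ?case
      by (simp add: field_simps)
  qed (simp add: \<open>coeff p 0 = 1\<close>)
  then show ?thesis by (simp add: p_def)
qed

section \<open>Jackson's convolution formula\<close>

text \<open>These are the coefficients \<open>a\<^sub>k\<close> whose squares generate
  \<open>F\<close>.\<close>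

definition jterm :: "'a::field \<Rightarrow> nat \<Rightarrow> 'a" where
  "jterm q i = qpoch q (q^4) i / qpoch (q^4) (q^4) i"

text \<open>The summand of the theorem stripped of \<open>(- q) ^ k\<close>, at a field element
  \<open>q\<close>.\<close>

definition jcoeff :: "'a::field \<Rightarrow> nat \<Rightarrow> 'a" where
  "jcoeff q k = (qpoch q (q\<^sup>2) k)\<^sup>2 * qpoch (q\<^sup>2) (q^4) k /
     ((qpoch (q\<^sup>2) (q\<^sup>2) k)\<^sup>2 * qpoch (q^4) (q^4) k)"

lemma power_4_mult: "x ^ (4 * m) = (x ^ (2 * m))\<^sup>2" for x :: "'a::monoid_mult"
  by (simp flip: power_mult)

text \<open>In multiplied form only the newest denominator factor has to be nonzero: if an earlier
  one vanishes, both sides are 0.\<close>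

lemma jterm_Suc:
  fixes q :: "'a::field"
  assumes "q ^ (4 * Suc i) \<noteq> 1"
  shows "jterm q (Suc i) * (1 - q ^ (4 * Suc i)) = jterm q i * (1 - q * q ^ (4 * i))"
proof -
  have "a * b / (c * d) * d = a / c * b" if "d \<noteq> 0" for a b c d :: 'a
    using that by simp
  from this[of "1 - q ^ (4 * Suc i)"] assms show ?thesis
    by (simp add: jterm_def flip: power_mult power_add)
qed

lemma jcoeff_Suc:
  fixes q :: "'a::field"
  assumes "q ^ (4 * Suc k) \<noteq> 1"
  shows "jcoeff q (Suc k) * ((1 - q ^ (2 * Suc k))\<^sup>2 * (1 - q ^ (4 * Suc k)))
       = jcoeff q k * ((1 - q * q ^ (2 * k))\<^sup>2 * (1 - q\<^sup>2 * q ^ (4 * k)))"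
proof -
  have "q ^ (2 * Suc k) \<noteq> 1"
    using assms by (metis power_4_mult one_power2)
  have "a * b\<^sup>2 * (c * d) / ((e * f)\<^sup>2 * (g * h)) * (f\<^sup>2 * h) = a * c / (e\<^sup>2 * g) * (b\<^sup>2 * d)"
    if "f \<noteq> 0" "h \<noteq> 0" for a b c d e f g h :: 'a
    using that by (simp add: field_simps)
  from this[of "1 - q ^ (2 * Suc k)" "1 - q ^ (4 * Suc k)"] \<open>q ^ (2 * Suc k) \<noteq> 1\<close> assms show ?thesis
    by (simp add: jcoeff_def power_mult_distrib flip: power_mult power_add)
qed

text \<open>
  The symmetric weight \<open>q^(2j) + q^(2(k-j))\<close>, rather than \<open>q^(2j)\<close>, makes the sum amenable to
  telescoping by a first-order recurrence in \<open>k\<close>.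
\<close>

lemma jackson_convolution_sym:
  fixes q :: "'a::field"
  assumes "\<And>i. 0 < i \<Longrightarrow> i \<le> k \<Longrightarrow> q ^ (4 * i) \<noteq> 1"
  shows "(\<Sum>j\<le>k. (jterm q j)\<^sup>2 * (jterm q (k - j))\<^sup>2 * (q ^ (2 * j) + q ^ (2 * (k - j)))) = 2 * jcoeff q k"
    (is "?s k = _")
  using assms
proof (induction k)
  case 0
  then show ?case by (simp add: jterm_def jcoeff_def)
next
  case (Suc k)
  define Y where "Y = q ^ (2 * k)"
  \<comment> \<open>By \<open>jcoeff_Suc\<close>,
    \<open>jcoeff q (Suc k) * a = jcoeff q k * b\<close>; the aim is the same recurrence for
    \<open>?s\<close>.\<close>
  define a where "a = (1 - q\<^sup>2 * Y)\<^sup>2 * (1 - q ^ 4 * Y\<^sup>2)"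
  define b where "b = (1 - q * Y)\<^sup>2 * (1 - q\<^sup>2 * Y\<^sup>2)"
  \<comment> \<open>The telescoping partner from the certificate. Its factor
    \<open>(1 - q ^ (4 * j))\<^sup>2\<close> makes it vanish at \<open>j = 0\<close>.\<close>
  define g where "g j = (jterm q j)\<^sup>2 * (jterm q (Suc k - j))\<^sup>2 * (1 - q ^ (4 * j))\<^sup>2
      * (q ^ (2 * j) * (q ^ (2 * (Suc k - j))) ^ 4 - q ^ (2 * (Suc k - j)))" for j
  have Y2: "q ^ (4 * k) = Y\<^sup>2"
    by (simp add: Y_def power_4_mult)
  have step: "(jterm q j)\<^sup>2 * (jterm q (Suc k - j))\<^sup>2 * (q ^ (2 * j) + q ^ (2 * (Suc k - j))) * a
      - (jterm q j)\<^sup>2 * (jterm q (k - j))\<^sup>2 * (q ^ (2 * j) + q ^ (2 * (k - j))) * b = g (Suc j) - g j"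
    if "j \<le> k" for j
  proof -
    define i where "i = k - j"
    define x where "x = q ^ (2 * j)"
    define y where "y = q ^ (2 * i)"
    have k: "k = i + j" using that by (simp add: i_def)
    have x2: "q ^ (4 * j) = x\<^sup>2" "q ^ (4 * Suc j) = q ^ 4 * x\<^sup>2" "q ^ (2 * Suc j) = q\<^sup>2 * x"
      and y2: "q ^ (4 * i) = y\<^sup>2" "q ^ (4 * Suc i) = q ^ 4 * y\<^sup>2" "q ^ (2 * Suc i) = q\<^sup>2 * y"
      and Yxy: "Y = x * y"
      by (simp_all add: x_def y_def Y_def k power_add power_4_mult power2_eq_square distrib_left)
    have ne: "1 - q ^ 4 * y\<^sup>2 \<noteq> 0" "1 - q ^ 4 * x\<^sup>2 \<noteq> 0"
      using Suc.prems[of "Suc i"] Suc.prems[of "Suc j"] by (simp_all only: x2 y2) (auto simp: k)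
    have u: "(jterm q (Suc j))\<^sup>2 * (1 - q ^ 4 * x\<^sup>2)\<^sup>2 = (jterm q j)\<^sup>2 * (1 - q * x\<^sup>2)\<^sup>2"
      using jterm_Suc[of q j] ne by (simp only: x2 flip: power_mult_distrib) auto
    have v: "(jterm q (Suc i))\<^sup>2 * (1 - q ^ 4 * y\<^sup>2)\<^sup>2 = (jterm q i)\<^sup>2 * (1 - q * y\<^sup>2)\<^sup>2"
      using jterm_Suc[of q i] ne by (simp only: y2 flip: power_mult_distrib) auto
    \<comment> \<open>The squared \<open>jterm\<close> values matter only through their ratios, so
      they become free variables, with \<open>u'\<close> and \<open>v'\<close> at the successor
      indices. Multiplying by \<open>D\<close>, the denominator of the ratio \<open>v' / v\<close>,
      leaves \<open>u * v\<close> times \<open>jackson_certificate\<close>.\<close>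
    have cert: "u * v' * (x + q\<^sup>2 * y) * a - u * v * (x + y) * b
        = u' * v * (1 - q ^ 4 * x\<^sup>2)\<^sup>2 * (q\<^sup>2 * x * y ^ 4 - y)
          - u * v' * (1 - x\<^sup>2)\<^sup>2 * (x * (q\<^sup>2 * y) ^ 4 - q\<^sup>2 * y)"
      if u: "u' * (1 - q ^ 4 * x\<^sup>2)\<^sup>2 = u * (1 - q * x\<^sup>2)\<^sup>2"
        and v: "v' * (1 - q ^ 4 * y\<^sup>2)\<^sup>2 = v * (1 - q * y\<^sup>2)\<^sup>2"
      for u u' v v'
    proof -
      define D where "D = (1 - q ^ 4 * y\<^sup>2)\<^sup>2"
      have D: "D \<noteq> 0" using ne by (simp add: D_def)
      have "D * (u * v' * (x + q\<^sup>2 * y) * a - u * v * (x + y) * b)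
          = u * (v' * D) * (x + q\<^sup>2 * y) * a - D * (u * v * (x + y) * b)"
        by (simp add: algebra_simps)
      also have "\<dots> = u * v * (((1 - q^2*x*y)^2 * (1 - q^4*x^2*y^2) * ((1 - q*y^2)^2 * (x + q^2*y)))
      - ((1 - q*x*y)^2 * (1 - q^2*x^2*y^2) * ((1 - q^4*y^2)^2 * (x + y))))"
        unfolding D_def v a_def b_def Yxy power_mult_distrib[of x y] right_diff_distrib[of "u * v"]
        by (simp only: ac_simps)
      also have "\<dots> = D * (u * (1 - q * x\<^sup>2)\<^sup>2) * v * (q\<^sup>2 * x * y ^ 4 - y)
          - u * (v * (1 - q * y\<^sup>2)\<^sup>2) * (1 - x\<^sup>2)\<^sup>2 * (q ^ 8 * x * y ^ 4 - q\<^sup>2 * y)"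
        unfolding D_def jackson_certificate right_diff_distrib[of "u * v"] by (simp only: ac_simps)
      also have "\<dots> = D * (u' * v * (1 - q ^ 4 * x\<^sup>2)\<^sup>2 * (q\<^sup>2 * x * y ^ 4 - y)
          - u * v' * (1 - x\<^sup>2)\<^sup>2 * (x * (q\<^sup>2 * y) ^ 4 - q\<^sup>2 * y))"
        unfolding u[symmetric] v[symmetric] D_def[symmetric] right_diff_distrib[of D] power_mult_distrib[of _ y]
        by (simp add: ac_simps flip: power_mult)
      finally show ?thesis using D by simp
    qed
    have idx: "Suc k - j = Suc i" "k - j = i" "Suc k - Suc j = i" by (simp_all add: k)
    show ?thesis
      using cert[OF u v] unfolding g_def idx x2 y2 x_def[symmetric] y_def[symmetric] .
  qed
  \<comment> \<open>The differences cover only \<open>j \<le> k\<close>; this boundary value cancels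
    the remaining summand \<open>j = Suc k\<close> of \<open>?s (Suc k) * a\<close>.\<close>
  have gk: "g (Suc k) = - ((jterm q (Suc k))\<^sup>2 * (1 + q ^ (2 * Suc k)) * a)"
  proof -
    define z where "z = q\<^sup>2 * Y"
    have "q ^ (2 * Suc k) = z" and z2: "q ^ 4 * Y\<^sup>2 = z\<^sup>2"
      by (simp_all add: z_def Y_def power2_eq_square power4_eq_xxxx)
    moreover have "q ^ (4 * Suc k) = z\<^sup>2"
      by (simp only: power_4_mult \<open>q ^ (2 * Suc k) = z\<close>)
    moreover have "(1 - z\<^sup>2)\<^sup>2 * (z - 1) = - ((1 + z) * ((1 - z)\<^sup>2 * (1 - z\<^sup>2)))"
      by (simp add: power2_eq_square algebra_simps)
    ultimately show ?thesis
      by (simp add: g_def a_def z_def[symmetric] z2 jterm_def[of q 0] mult.assoc del: mult_Suc_right power_Suc)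
  qed
  have "?s (Suc k) * a - ?s k * b = (\<Sum>j\<le>k. g (Suc j) - g j)
      + (jterm q (Suc k))\<^sup>2 * (1 + q ^ (2 * Suc k)) * a"
    by (simp add: step[symmetric] sum_subtractf sum_distrib_right distrib_right jterm_def[of q 0] add_ac
             del: mult_Suc_right)
  also have "(\<Sum>j\<le>k. g (Suc j) - g j) = g (Suc k) - g 0"
    by (subst lessThan_Suc_atMost[symmetric]) (rule sum_lessThan_telescope)
  also have "g 0 = 0" by (simp add: g_def)
  finally have "?s (Suc k) * a = ?s k * b" by (simp add: gk)
  also have "?s k = 2 * jcoeff q k" by (intro Suc.IH Suc.prems) auto
  also have "\<dots> * b = 2 * jcoeff q (Suc k) * a"
  proof -
    have p: "q ^ (2 * Suc k) = q\<^sup>2 * Y" "q ^ (4 * Suc k) = q ^ 4 * Y\<^sup>2"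
      by (simp_all add: Y_def power_add power_4_mult power2_eq_square distrib_left)
    have "q ^ (4 * Suc k) \<noteq> 1" by (intro Suc.prems) auto
    from jcoeff_Suc[OF this] show ?thesis
      unfolding a_def b_def p Y2 Y_def[symmetric] by (simp add: mult.assoc)
  qed
  finally have "?s (Suc k) * a = 2 * jcoeff q (Suc k) * a" .
  moreover have "a \<noteq> 0"
  proof -
    have "q ^ (4 * Suc k) = (q\<^sup>2 * Y)\<^sup>2" "q ^ (4 * Suc k) = q ^ 4 * Y\<^sup>2"
      by (simp_all add: Y2[symmetric] power_add power_mult_distrib flip: power_mult)
    moreover have "q ^ (4 * Suc k) \<noteq> 1" by (intro Suc.prems) auto
    ultimately show ?thesis by (auto simp: a_def)
  qed
  ultimately show ?case by simp
qed

text \<open>Exchanging \<open>j\<close> and \<open>k - j\<close> shows that both halves of the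
  symmetric weight contribute equally, and 2 is invertible in characteristic 0.\<close>

lemma jackson_convolution:
  fixes q :: "'a::field_char_0"
  assumes "\<And>i. 0 < i \<Longrightarrow> i \<le> k \<Longrightarrow> q ^ (4 * i) \<noteq> 1"
  shows "(\<Sum>j\<le>k. (jterm q j)\<^sup>2 * ((q\<^sup>2) ^ (k - j) * (jterm q (k - j))\<^sup>2)) = jcoeff q k"
    (is "?S = _")
proof -
  have "?S = (\<Sum>j\<le>k. (jterm q j)\<^sup>2 * (jterm q (k - j))\<^sup>2 * q ^ (2 * j))"
    by (rule sum.reindex_bij_witness[of _ "\<lambda>j. k - j" "\<lambda>j. k - j"])
       (auto simp: mult_ac simp flip: power_mult)
  moreover have "?S = (\<Sum>j\<le>k. (jterm q j)\<^sup>2 * (jterm q (k - j))\<^sup>2 * q ^ (2 * (k - j)))"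
    by (intro sum.cong) (auto simp: mult_ac simp flip: power_mult)
  ultimately have "2 * ?S = 2 * jcoeff q k"
    using jackson_convolution_sym[of k q, OF assms] by (simp add: distrib_left sum.distrib)
  then show ?thesis by simp
qed

section \<open>Product manipulations for the closed form\<close>

lemma prod_lessThan_double: "(\<Prod>j<2 * m. f j) = (\<Prod>j<m. f (2 * j) * f (2 * j + 1))"
  for f :: "nat \<Rightarrow> 'a::comm_monoid_mult"
  by (induction m) (simp_all add: mult_ac)

text \<open>With denominators cleared, this matches the two q-binomial values with the closed form.
  Splitting by parity and by \<open>qpoch_mult_minus\<close> reduces both sides to the same product
  of symbols with base \<open>q^4\<close>, length \<open>r\<close> and first arguments
  \<open>q\<close>, \<open>-q\<close>, \<open>-q^3\<close>, \<open>q^2\<close>, \<open>-q^2\<close>,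
  \<open>q^4\<close>, \<open>-q^4\<close>.\<close>

lemma qpoch_product_identity:
  fixes q :: "'a::comm_ring_1"
  shows "qpoch (q\<^sup>2) (q^8) r * qpoch q (- q\<^sup>2) (2 * r) * (qpoch (q^4) (q^4) (2 * r))\<^sup>2
    = (qpoch q (q^4) r * qpoch (q\<^sup>2) (q^4) r)\<^sup>2 * qpoch (- q) q (4 * r)
      * (qpoch (q^8) (q^8) r * qpoch (- q\<^sup>2) (- q\<^sup>2) (2 * r))"
proof -
  have pow: "(q^4)\<^sup>2 = q^8" "(q\<^sup>2)\<^sup>2 = q^4" "(- q\<^sup>2)\<^sup>2 = q^4" "q * (- q\<^sup>2) = - (q^3)"
    "q^4 * q^4 = q^8" "- q * q = - q\<^sup>2" "- q * q\<^sup>2 = - (q^3)" "- q\<^sup>2 * - q\<^sup>2 = q^4"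
    "- q\<^sup>2 * q\<^sup>2 = - (q^4)"
    by (simp_all add: eval_nat_numeral)
  have "qpoch (q\<^sup>2) (q^8) r = qpoch q (q^4) r * qpoch (- q) (q^4) r"
    using qpoch_mult_minus[of q "q^4" r] by (simp add: pow)
  moreover have "qpoch q (- q\<^sup>2) (2 * r) = qpoch q (q^4) r * qpoch (- (q^3)) (q^4) r"
    using qpoch_double[of q "- q\<^sup>2" r] by (simp only: pow)
  moreover have "qpoch (q^4) (q^4) (2 * r) = qpoch (q^4) (q^8) r * qpoch (q^8) (q^8) r"
    using qpoch_double[of "q^4" "q^4" r] by (simp only: pow)
  moreover have "qpoch (q^4) (q^8) r = qpoch (q\<^sup>2) (q^4) r * qpoch (- (q\<^sup>2)) (q^4) r"
    using qpoch_mult_minus[of "q\<^sup>2" "q^4" r] by (simp only: pow)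
  moreover have "qpoch (q^8) (q^8) r = qpoch (q^4) (q^4) r * qpoch (- (q^4)) (q^4) r"
    using qpoch_mult_minus[of "q^4" "q^4" r] by (simp only: pow)
  moreover have "qpoch (- q\<^sup>2) (- q\<^sup>2) (2 * r) = qpoch (- q\<^sup>2) (q^4) r * qpoch (q^4) (q^4) r"
    using qpoch_double[of "- q\<^sup>2" "- q\<^sup>2" r] by (simp only: pow)
  moreover have "qpoch (- q) q (4 * r) = qpoch (- q) (q\<^sup>2) (2 * r) * qpoch (- q\<^sup>2) (q\<^sup>2) (2 * r)"
    using qpoch_double[of "- q" q "2 * r"] by (simp only: pow mult.assoc[symmetric]) simp
  moreover have "qpoch (- q) (q\<^sup>2) (2 * r) = qpoch (- q) (q^4) r * qpoch (- (q^3)) (q^4) r"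
    using qpoch_double[of "- q" "q\<^sup>2" r] by (simp only: pow)
  moreover have "qpoch (- q\<^sup>2) (q\<^sup>2) (2 * r) = qpoch (- q\<^sup>2) (q^4) r * qpoch (- (q^4)) (q^4) r"
    using qpoch_double[of "- q\<^sup>2" "q\<^sup>2" r] by (simp only: pow)
  ultimately show ?thesis
    by (simp add: power2_eq_square mult_ac)
qed

lemma coeff_pcompose_square: "coeff (pcompose p [:0, 0, 1:]) (2 * m) = coeff p m"
  for p :: "'a::comm_semiring_1 poly"
  by (induction p arbitrary: m) (auto simp: pcompose_pCons coeff_pCons split: nat.splits)

section \<open>Evaluation of the sum at a root of unity\<close>

text \<open>This abstracts a primitive root of unity of order \<open>4 * M + 1\<close>. The second
  assumption keeps every denominator of the sum nonzero: the powers \<open>q ^ (4 * i)\<close> occur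
  directly, and they are the squares of the powers \<open>q ^ (2 * i)\<close>.\<close>

locale quarter_root =
  fixes q :: "'a::field_char_0" and M :: nat
  assumes root: "q ^ (4 * M + 1) = 1"
    and primitive: "\<And>i. 0 < i \<Longrightarrow> i \<le> 2 * M \<Longrightarrow> q ^ (4 * i) \<noteq> 1"
begin

lemma q_nonzero: "q \<noteq> 0"
  using root by auto

lemma root': "q * q ^ (4 * M) = 1" "q * (q ^ 4) ^ M = 1"
  using root by (simp_all add: power_mult)

lemma jterm_eq_0: "jterm q k = 0" if "k > M"
proof -
  \<comment> \<open>The factor of index \<open>M\<close> is
    \<open>1 - q * (q ^ 4) ^ M = 0\<close>.\<close>
  have "qpoch q (q^4) (Suc M + (k - Suc M)) = 0"
    unfolding qpoch_add qpoch_Suc root'(2) by simp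
  with that show ?thesis by (simp add: jterm_def)
qed

text \<open>Both factors are polynomials in \<open>z\<close> of degree at most \<open>M\<close>, so
  stopping at \<open>2 * M\<close> loses no coefficient of the product, and up to there the
  convolution formula applies.\<close>

lemma sum_factorization:
  "(\<Sum>k\<le>2 * M. jcoeff q k * z ^ k)
   = (\<Sum>k\<le>M. (jterm q k)\<^sup>2 * z ^ k) * (\<Sum>k\<le>M. (jterm q k)\<^sup>2 * (q\<^sup>2 * z) ^ k)"
proof -
  define A where "A = (\<Sum>i\<le>M. monom ((jterm q i)\<^sup>2) i)"
  define B where "B = (\<Sum>i\<le>M. monom ((q\<^sup>2) ^ i * (jterm q i)\<^sup>2) i)"
  have A: "coeff A i = (jterm q i)\<^sup>2" and B: "coeff B i = (q\<^sup>2) ^ i * (jterm q i)\<^sup>2" for i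
    by (simp_all add: A_def B_def coeff_sum jterm_eq_0)
  have "degree A \<le> M" "degree B \<le> M"
    by (auto intro!: degree_le simp: A B jterm_eq_0)
  then have "degree (A * B) \<le> 2 * M"
    by (intro order.trans[OF degree_mult_le]) simp
  have "(\<Sum>k\<le>2 * M. jcoeff q k * z ^ k) = (\<Sum>k\<le>2 * M. coeff (A * B) k * z ^ k)"
    unfolding coeff_mult A B by (intro sum.cong arg_cong2[where f = "(*)"] jackson_convolution[symmetric] primitive) auto
  also have "\<dots> = poly (\<Sum>k\<le>2 * M. monom (coeff (A * B) k) k) z"
    by (simp add: poly_sum poly_monom)
  also have "(\<Sum>k\<le>2 * M. monom (coeff (A * B) k) k) = A * B"
    by (rule poly_as_sum_of_monoms') fact
  also have "poly (A * B) z = poly A z * poly B z"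
    by simp
  also have "\<dots> = (\<Sum>k\<le>M. (jterm q k)\<^sup>2 * z ^ k) * (\<Sum>k\<le>M. (jterm q k)\<^sup>2 * (q\<^sup>2 * z) ^ k)"
    by (simp add: A_def B_def poly_sum poly_monom power_mult_distrib mult_ac)
  finally show ?thesis .
qed

text \<open>For \<open>i + k + 1 = M\<close>, the powers \<open>q * q ^ (4 * i)\<close> and
  \<open>q ^ (4 * Suc k)\<close> are mutually inverse. Hence the ratio of consecutive terms counted
  down from \<open>M\<close> equals the one counted up from 0, up to a power of
  \<open>q\<close>.\<close>

lemma jterm_reflect: "k \<le> M \<Longrightarrow> jterm q (M - k) = jterm q M * jterm q k * q ^ (3 * k)"
proof (induction k)
  case 0
  then show ?case by (simp add: jterm_def)
next
  case (Suc k)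
  define i where "i = M - Suc k"
  have M: "M = Suc i + k" and i: "M - k = Suc i" "M - Suc k = i"
    using Suc.prems by (auto simp: i_def)
  have ne: "q ^ (4 * Suc i) \<noteq> 1" "q ^ (4 * Suc k) \<noteq> 1"
    using Suc.prems by (intro primitive; simp add: M)+
  have p: "q ^ (4 * Suc i) * (q * q ^ (4 * k)) = 1" "(q * q ^ (4 * i)) * q ^ (4 * Suc k) = 1"
  proof -
    have "4 * Suc i + Suc (4 * k) = 4 * M + 1" "Suc (4 * i) + 4 * Suc k = 4 * M + 1"
      by (simp_all add: M)
    then show "q ^ (4 * Suc i) * (q * q ^ (4 * k)) = 1" "(q * q ^ (4 * i)) * q ^ (4 * Suc k) = 1"
      using root by (simp_all only: power_add[symmetric] power_Suc[symmetric])
  qed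
  have "jterm q i * (q ^ (4 * Suc k) - 1) = jterm q i * (1 - q * q ^ (4 * i)) * q ^ (4 * Suc k)"
    using p(2) by (simp add: algebra_simps)
  also have "\<dots> = jterm q (Suc i) * (1 - q ^ (4 * Suc i)) * q ^ (4 * Suc k)"
    by (simp only: jterm_Suc[OF ne(1)])
  \<comment> \<open>Splitting \<open>q ^ (4 * Suc k)\<close> as
    \<open>q ^ 3 * (q * q ^ (4 * k))\<close> yields the factor \<open>q ^ 3\<close> gained at each
    step.\<close>
  also have "\<dots> = jterm q (Suc i) * q ^ 3 * ((1 - q ^ (4 * Suc i)) * (q * q ^ (4 * k)))"
    by (simp add: power_add eval_nat_numeral mult_ac)
  also have "(1 - q ^ (4 * Suc i)) * (q * q ^ (4 * k)) = q * q ^ (4 * k) - 1"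
    using p(1) by (simp only: left_diff_distrib mult_1)
  also have "jterm q (Suc i) * q ^ 3 * (q * q ^ (4 * k) - 1)
      = - (jterm q M * q ^ (3 * Suc k) * (jterm q k * (1 - q * q ^ (4 * k))))"
    using Suc.IH Suc.prems by (simp add: i power_add algebra_simps)
  also have "\<dots> = jterm q M * jterm q (Suc k) * q ^ (3 * Suc k) * (q ^ (4 * Suc k) - 1)"
    unfolding jterm_Suc[OF ne(2), symmetric] by (simp add: algebra_simps del: power_Suc mult_Suc_right)
  finally show ?case
    using ne(2) by (simp add: i)
qed

text \<open>Reflection at \<open>k = M\<close>, where the left side is
  \<open>jterm q 0 = 1\<close>.\<close>

lemma jterm_top: "(jterm q M)\<^sup>2 * q ^ (3 * M) = 1"
  using jterm_reflect[of M] by (simp add: jterm_def[of q 0] power2_eq_square)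

lemma coeff_jterm:
  assumes "k \<le> M"
  shows "coeff (\<Prod>j<M. [:1, - (c * (q * (q ^ 4) ^ j)):]) k = c ^ k * jterm q k"
  unfolding jterm_def
  by (rule coeff_qbinomial) (use assms primitive in \<open>auto simp: root' simp flip: power_mult\<close>)

text \<open>Reflection turns each summand into \<open>c ^ k * jterm q k * jterm q (M - k)\<close>,
  so the sum is a Cauchy product of two q-binomial expansions.\<close>

lemma jterm_sum_eq_coeff:
  "jterm q M * (\<Sum>k\<le>M. (jterm q k)\<^sup>2 * (c * q ^ 3) ^ k)
   = coeff ((\<Prod>j<M. [:1, - (c * (q * (q ^ 4) ^ j)):]) * (\<Prod>j<M. [:1, - (1 * (q * (q ^ 4) ^ j)):])) M"
  unfolding coeff_mult sum_distrib_left
proof (rule sum.cong)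
  fix k assume "k \<in> {..M}"
  then show "jterm q M * ((jterm q k)\<^sup>2 * (c * q ^ 3) ^ k) =
    coeff (\<Prod>j<M. [:1, - (c * (q * (q ^ 4) ^ j)):]) k *
    coeff (\<Prod>j<M. [:1, - (1 * (q * (q ^ 4) ^ j)):]) (M - k)"
    by (simp only: coeff_jterm atMost_iff diff_le_self jterm_reflect)
       (simp add: power2_eq_square power_mult_distrib mult_ac flip: power_mult)
qed simp

lemma minus_q2_power:
  assumes "0 < i" "i \<le> M"
  shows "(- q\<^sup>2) ^ i \<noteq> 1"
proof
  assume "(- q\<^sup>2) ^ i = 1"
  then have "((- q\<^sup>2) ^ i)\<^sup>2 = 1" by simp
  then have "q ^ (4 * i) = 1"
    by (simp add: mult_ac flip: power_mult)
  with primitive[of i] assms show False by simp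
qed

lemma sum_minus_q:
  "jterm q M * (\<Sum>k\<le>M. (jterm q k)\<^sup>2 * (- q) ^ k)
   = (- 1 / q\<^sup>2) ^ M * (qpoch q (- q\<^sup>2) M / qpoch (- q\<^sup>2) (- q\<^sup>2) M)"
proof -
  \<comment> \<open>The first equation for \<open>c\<close> fits \<open>jterm_sum_eq_coeff\<close>.
    The second interleaves both products into one progression of ratio \<open>- q\<^sup>2\<close>:
    even indices give the factors with \<open>c\<close>, odd ones those with 1.\<close>
  define c where "c = - 1 / q\<^sup>2"
  have c: "c * q ^ 3 = - q" "c * (- q\<^sup>2) = 1"
    using q_nonzero by (simp_all add: c_def eval_nat_numeral)
  have "[:1, - (c * (q * (- q\<^sup>2) ^ (2 * j))):] * [:1, - (c * (q * (- q\<^sup>2) ^ (2 * j + 1))):]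
      = [:1, - (c * (q * (q ^ 4) ^ j)):] * [:1, - (1 * (q * (q ^ 4) ^ j)):]" for j
  proof -
    have "(- q\<^sup>2) ^ (2 * j) = (q ^ 4) ^ j"
      by (simp flip: power_mult)
    moreover have "c * (q * (- q\<^sup>2) ^ (2 * j + 1)) = (c * (- q\<^sup>2)) * (q * (- q\<^sup>2) ^ (2 * j))"
      by simp
    ultimately show ?thesis by (simp only: c)
  qed
  then have "(\<Prod>j<M. [:1, - (c * (q * (q ^ 4) ^ j)):]) * (\<Prod>j<M. [:1, - (1 * (q * (q ^ 4) ^ j)):])
      = (\<Prod>j<2 * M. [:1, - (c * (q * (- q\<^sup>2) ^ j)):])"
    by (simp only: prod_lessThan_double prod.distrib[symmetric])
  then have "jterm q M * (\<Sum>k\<le>M. (jterm q k)\<^sup>2 * (- q) ^ k)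
      = coeff (\<Prod>j<2 * M. [:1, - (c * (q * (- q\<^sup>2) ^ j)):]) M"
    using jterm_sum_eq_coeff[of c] by (simp only: c)
  also have "\<dots> = c ^ M * (qpoch q (- q\<^sup>2) M / qpoch (- q\<^sup>2) (- q\<^sup>2) M)"
  proof (rule coeff_qbinomial)
    show "q * (- q\<^sup>2) ^ (2 * M) = 1"
      using root'(1) by (simp flip: power_mult)
    fix i assume i: "0 < i" "i \<le> M"
    then show "(- q\<^sup>2) ^ i \<noteq> 1" by (rule minus_q2_power)
  qed
  finally show ?thesis by (simp only: c_def)
qed

text \<open>After reflection the summand is \<open>(-1) ^ k * (jterm q k * jterm q (M - k))\<close>,
  which changes sign under reversal when \<open>M\<close> is odd.\<close>

lemma sum_minus_q3_odd:
  assumes "odd M"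
  shows "(\<Sum>k\<le>M. (jterm q k)\<^sup>2 * (- (q ^ 3)) ^ k) = 0"
proof -
  define S where "S = (\<Sum>k\<le>M. (-1) ^ k * (jterm q k * jterm q (M - k)))"
  have "S = (\<Sum>k\<le>M. (-1) ^ (M - k) * (jterm q (M - k) * jterm q k))"
    unfolding S_def
    by (rule sum.reindex_bij_witness[of _ "\<lambda>j. M - j" "\<lambda>j. M - j"]) auto
  also have "\<dots> = - S"
    unfolding S_def sum_negf[symmetric] using assms
    by (intro sum.cong) (auto simp: mult_ac minus_one_power_iff)
  finally have "S + S = 0"
    by (rule eq_neg_iff_add_eq_0[THEN iffD1])
  then have "S = 0"
    by (simp flip: mult_2)
  moreover have "jterm q M * (\<Sum>k\<le>M. (jterm q k)\<^sup>2 * (- (q ^ 3)) ^ k) = S"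
    unfolding sum_distrib_left S_def
    by (intro sum.cong)
       (auto simp: jterm_reflect power2_eq_square power_minus[of "q ^ 3"] mult_ac simp flip: power_mult)
  moreover have "jterm q M \<noteq> 0"
    using jterm_top by auto
  ultimately show ?thesis
    by simp
qed

lemma sum_minus_q3_even:
  assumes M: "M = 2 * r"
  shows "jterm q M * (\<Sum>k\<le>M. (jterm q k)\<^sup>2 * (- (q ^ 3)) ^ k)
    = qpoch (q\<^sup>2) (q ^ 8) r / qpoch (q ^ 8) (q ^ 8) r"
proof -
  have "[:1, - (- 1 * (q * (q ^ 4) ^ j)):] * [:1, - (1 * (q * (q ^ 4) ^ j)):]
      = pcompose [:1, - (1 * (q\<^sup>2 * (q ^ 8) ^ j)):] [:0, 0, 1:]" for j
    by (simp add: pcompose_pCons monom_altdef power2_eq_square mult_ac flip: power_mult power_add)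
  then have "(\<Prod>j<M. [:1, - (- 1 * (q * (q ^ 4) ^ j)):]) * (\<Prod>j<M. [:1, - (1 * (q * (q ^ 4) ^ j)):])
      = pcompose (\<Prod>j<M. [:1, - (1 * (q\<^sup>2 * (q ^ 8) ^ j)):]) [:0, 0, 1:]"
    by (simp only: pcompose_prod prod.distrib[symmetric])
  then have "jterm q M * (\<Sum>k\<le>M. (jterm q k)\<^sup>2 * (- (q ^ 3)) ^ k)
      = coeff (pcompose (\<Prod>j<M. [:1, - (1 * (q\<^sup>2 * (q ^ 8) ^ j)):]) [:0, 0, 1:]) (2 * r)"
    using jterm_sum_eq_coeff[of "- 1"] by (simp add: M)
  also have "\<dots> = coeff (\<Prod>j<M. [:1, - (1 * (q\<^sup>2 * (q ^ 8) ^ j)):]) r"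
    by (rule coeff_pcompose_square)
  also have "\<dots> = 1 ^ r * (qpoch (q\<^sup>2) (q ^ 8) r / qpoch (q ^ 8) (q ^ 8) r)"
  proof (rule coeff_qbinomial)
    \<comment> \<open>All \<open>M\<close> factors remain, now in the squared variable, so the
      q-binomial length is \<open>M\<close> although the coefficient sought is at
      \<open>r\<close>.\<close>
    have "q\<^sup>2 * (q ^ 8) ^ M = (q * q ^ (4 * M))\<^sup>2"
      by (simp add: power_mult_distrib flip: power_mult)
    then show "q\<^sup>2 * (q ^ 8) ^ M = 1"
      by (simp add: root')
    fix i assume i: "0 < i" "i \<le> r"
    show "(q ^ 8) ^ i \<noteq> 1"
      using primitive[of "2 * i"] i by (simp add: M flip: power_mult)
  qed
  finally show ?thesis by simp
qed

lemma sum_jcoeff: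
  "(\<Sum>k\<le>2 * M. jcoeff q k * (- q) ^ k) =
    (if even M then
      (qpoch q (q ^ 4) (M div 2) * qpoch (q\<^sup>2) (q ^ 4) (M div 2))\<^sup>2 * qpoch (- q) q (2 * M)
        / (qpoch (q ^ 4) (q ^ 4) M)\<^sup>2 / q ^ (4 * M\<^sup>2)
     else 0)"
proof -
  have q3: "q\<^sup>2 * - q = - (q ^ 3)"
    by (simp add: eval_nat_numeral)
  show ?thesis
  proof (cases "even M")
    case False
    then show ?thesis
      unfolding sum_factorization q3 sum_minus_q3_odd[OF False] by simp
  next
    case True
    then obtain r where M: "M = 2 * r" by auto
    let ?L = "\<Sum>k\<le>2 * M. jcoeff q k * (- q) ^ k"
    have ne4: "qpoch (q ^ 4) (q ^ 4) M \<noteq> 0"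
      by (rule qpoch_base_nonzero) (use primitive in \<open>auto simp flip: power_mult\<close>)
    have ne8: "qpoch (q ^ 8) (q ^ 8) r \<noteq> 0"
    proof (rule qpoch_base_nonzero)
      fix i assume "0 < i" "i \<le> r"
      then show "(q ^ 8) ^ i \<noteq> 1"
        using primitive[of "2 * i"] by (simp add: M flip: power_mult)
    qed
    have ne2: "qpoch (- q\<^sup>2) (- q\<^sup>2) M \<noteq> 0"
      by (rule qpoch_base_nonzero) (rule minus_q2_power)
    define X where "X = qpoch (q\<^sup>2) (q ^ 8) r * qpoch q (- q\<^sup>2) M"
    define Y where "Y = qpoch (q ^ 8) (q ^ 8) r * qpoch (- q\<^sup>2) (- q\<^sup>2) M"
    define U where "U = (qpoch q (q ^ 4) r * qpoch (q\<^sup>2) (q ^ 4) r)\<^sup>2 * qpoch (- q) q (2 * M)"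
    define V where "V = (qpoch (q ^ 4) (q ^ 4) M)\<^sup>2"
    have "X * V = U * Y"
      using qpoch_product_identity[of q r] by (simp add: X_def Y_def U_def V_def M)
    moreover have "V \<noteq> 0" "Y \<noteq> 0"
      using ne4 ne8 ne2 by (simp_all add: V_def Y_def)
    ultimately have XY: "X / Y = U / V"
      by (simp add: field_simps)
    have "(jterm q M)\<^sup>2 * ?L
      = (- 1 / q\<^sup>2) ^ M * (qpoch q (- q\<^sup>2) M / qpoch (- q\<^sup>2) (- q\<^sup>2) M)
        * (qpoch (q\<^sup>2) (q ^ 8) r / qpoch (q ^ 8) (q ^ 8) r)"
      unfolding sum_factorization q3 sum_minus_q[symmetric] sum_minus_q3_even[OF M, symmetric]
      by (simp add: power2_eq_square mult_ac)
    also have "\<dots> = (- 1 / q\<^sup>2) ^ M * (U / V)"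
      unfolding XY[symmetric] by (simp add: X_def Y_def mult_ac)
    also have "(- 1 / q\<^sup>2) ^ M = 1 / q ^ (2 * M)"
      using True by (simp add: power_divide flip: power_mult)
    finally have L: "(jterm q M)\<^sup>2 * ?L = U / V / q ^ (2 * M)"
      by simp
    \<comment> \<open>\<open>jterm_top\<close> trades the unwanted factor
      \<open>(jterm q M)\<^sup>2\<close> for a power of \<open>q\<close>.\<close>
    have "?L = ((jterm q M)\<^sup>2 * q ^ (3 * M)) * ?L"
      by (simp only: jterm_top mult_1)
    also have "\<dots> = q ^ (3 * M) * (U / V / q ^ (2 * M))"
      unfolding L[symmetric] by (simp only: mult_ac)
    also have "\<dots> = U / V * q ^ M"
    proof -
      have "q ^ (3 * M) = q ^ M * q ^ (2 * M)"
        by (simp flip: power_add)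
      then show ?thesis using q_nonzero by simp
    qed
    also have "\<dots> = U / V / q ^ (4 * M\<^sup>2)"
    proof -
      \<comment> \<open>As \<open>M + 4 * M\<^sup>2 = (4 * M + 1) * M\<close>, the leftover
        \<open>q ^ M\<close> is the negative power in the theorem.\<close>
      have "q ^ M * q ^ (4 * M\<^sup>2) = (q ^ (4 * M + 1)) ^ M"
        by (simp add: power2_eq_square algebra_simps flip: power_mult power_add)
      then have "q ^ M * q ^ (4 * M\<^sup>2) = 1"
        by (simp only: root power_one)
      then have "q ^ M = 1 / q ^ (4 * M\<^sup>2)"
        using q_nonzero by (simp add: eq_divide_eq)
      then show ?thesis by simp
    qed
    finally show ?thesis
      using True by (simp add: U_def V_def M)
  qed
qed

end

section \<open>Values of rational functions at finitely or infinitely many points\<close>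

text \<open>
  One fraction \<open>a / b\<close> must serve all points of \<open>Z\<close> at once, so that the denominator is coprime
  to the whole cyclotomic polynomial.
\<close>

definition evaluates_on :: "complex set \<Rightarrow> ratfun \<Rightarrow> (complex \<Rightarrow> complex) \<Rightarrow> bool" where
  "evaluates_on Z x v \<longleftrightarrow>
     (\<exists>a b. b \<noteq> 0 \<and> x = Fract a b \<and> (\<forall>z\<in>Z. poly b z \<noteq> 0 \<and> v z = poly a z / poly b z))"

lemma evaluates_onI:
  assumes "b \<noteq> 0" "x = Fract a b" "\<And>z. z \<in> Z \<Longrightarrow> poly b z \<noteq> 0"
    "\<And>z. z \<in> Z \<Longrightarrow> v z = poly a z / poly b z"
  shows "evaluates_on Z x v"
  using assms by (auto simp: evaluates_on_def)

lemma evaluates_on_0: "evaluates_on Z 0 (\<lambda>_. 0)"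
  by (rule evaluates_onI[of 1 _ 0]) (auto simp: Zero_fract_def)

lemma evaluates_on_1: "evaluates_on Z 1 (\<lambda>_. 1)"
  by (rule evaluates_onI[of 1 _ 1]) (auto simp: One_fract_def)

lemma evaluates_on_qvar: "evaluates_on Z qvar (\<lambda>z. z)"
  by (rule evaluates_onI[of 1 _ "[:0, 1:]"]) (auto simp: qvar_def)

lemma evaluates_on_uminus:
  assumes "evaluates_on Z x f"
  shows "evaluates_on Z (- x) (\<lambda>z. - f z)"
proof -
  from assms obtain a b where "b \<noteq> 0" "x = Fract a b"
    "\<And>z. z \<in> Z \<Longrightarrow> poly b z \<noteq> 0 \<and> f z = poly a z / poly b z"
    by (auto simp: evaluates_on_def)
  then show ?thesis
    by (intro evaluates_onI[of b _ "- a"]) auto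
qed

lemma evaluates_on_add:
  assumes "evaluates_on Z x f" "evaluates_on Z y g"
  shows "evaluates_on Z (x + y) (\<lambda>z. f z + g z)"
proof -
  obtain a b where "b \<noteq> 0" "x = Fract a b"
    "\<And>z. z \<in> Z \<Longrightarrow> poly b z \<noteq> 0 \<and> f z = poly a z / poly b z"
    using assms(1) by (auto simp: evaluates_on_def)
  moreover obtain c d where "d \<noteq> 0" "y = Fract c d"
    "\<And>z. z \<in> Z \<Longrightarrow> poly d z \<noteq> 0 \<and> g z = poly c z / poly d z"
    using assms(2) by (auto simp: evaluates_on_def)
  ultimately show ?thesis
    by (intro evaluates_onI[of "b * d" _ "a * d + c * b"]) (auto simp: field_simps)
qed

lemma evaluates_on_diff:
  assumes "evaluates_on Z x f" "evaluates_on Z y g"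
  shows "evaluates_on Z (x - y) (\<lambda>z. f z - g z)"
  using evaluates_on_add[OF assms(1) evaluates_on_uminus[OF assms(2)]] by simp

lemma evaluates_on_mult:
  assumes "evaluates_on Z x f" "evaluates_on Z y g"
  shows "evaluates_on Z (x * y) (\<lambda>z. f z * g z)"
proof -
  obtain a b where "b \<noteq> 0" "x = Fract a b"
    "\<And>z. z \<in> Z \<Longrightarrow> poly b z \<noteq> 0 \<and> f z = poly a z / poly b z"
    using assms(1) by (auto simp: evaluates_on_def)
  moreover obtain c d where "d \<noteq> 0" "y = Fract c d"
    "\<And>z. z \<in> Z \<Longrightarrow> poly d z \<noteq> 0 \<and> g z = poly c z / poly d z"
    using assms(2) by (auto simp: evaluates_on_def)
  ultimately show ?thesis
    by (intro evaluates_onI[of "b * d" _ "a * c"]) auto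
qed

lemma evaluates_on_divide:
  assumes "evaluates_on Z x f" "evaluates_on Z y g" "Z \<noteq> {}" "\<And>z. z \<in> Z \<Longrightarrow> g z \<noteq> 0"
  shows "evaluates_on Z (x / y) (\<lambda>z. f z / g z)"
proof -
  obtain a b where x: "b \<noteq> 0" "x = Fract a b"
    "\<And>z. z \<in> Z \<Longrightarrow> poly b z \<noteq> 0 \<and> f z = poly a z / poly b z"
    using assms(1) by (auto simp: evaluates_on_def)
  obtain c d where y: "d \<noteq> 0" "y = Fract c d"
    "\<And>z. z \<in> Z \<Longrightarrow> poly d z \<noteq> 0 \<and> g z = poly c z / poly d z"
    using assms(2) by (auto simp: evaluates_on_def)
  have "poly c z \<noteq> 0" if "z \<in> Z" for z
    using y(3)[OF that] assms(4)[OF that] by auto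
  \<comment> \<open>A point of the nonempty \<open>Z\<close> witnesses that \<open>c\<close>, now
    part of the denominator, is not the zero polynomial.\<close>
  moreover from this \<open>Z \<noteq> {}\<close> have "c \<noteq> 0" by auto
  ultimately show ?thesis
    using x y by (intro evaluates_onI[of "b * c" _ "a * d"]) (auto simp: field_simps)
qed

lemma evaluates_on_power:
  "evaluates_on Z x f \<Longrightarrow> evaluates_on Z (x ^ k) (\<lambda>z. f z ^ k)"
  by (induction k) (auto intro: evaluates_on_1 evaluates_on_mult)

lemma evaluates_on_sum:
  assumes "\<And>i. i \<in> A \<Longrightarrow> evaluates_on Z (x i) (f i)"
  shows "evaluates_on Z (\<Sum>i\<in>A. x i) (\<lambda>z. \<Sum>i\<in>A. f i z)"
  using assms
  by (induction A rule: infinite_finite_induct) (auto intro: evaluates_on_0 evaluates_on_add)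

lemma evaluates_on_qpoch:
  assumes "evaluates_on Z a f" "evaluates_on Z x g"
  shows "evaluates_on Z (qpoch a x k) (\<lambda>z. qpoch (f z) (g z) k)"
  using assms
  by (induction k)
     (auto intro!: evaluates_on_1 evaluates_on_mult evaluates_on_diff evaluates_on_power)

lemmas evaluates_on_intros =
  evaluates_on_qvar evaluates_on_uminus evaluates_on_mult evaluates_on_power evaluates_on_sum
  evaluates_on_qpoch evaluates_on_divide

section \<open>Coprimality and divisibility read off from roots\<close>

text \<open>A common divisor has no complex root, hence is constant by the fundamental theorem of
  algebra.\<close>

lemma coprime_complex_polyI:
  fixes p q :: "complex poly"
  assumes "p \<noteq> 0" "\<And>z. poly q z = 0 \<Longrightarrow> poly p z \<noteq> 0"
  shows "coprime p q"
proof (rule coprimeI)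
  fix d assume d: "d dvd p" "d dvd q"
  then have "d \<noteq> 0" using assms(1) by auto
  have "poly d z \<noteq> 0" for z
    using d assms(2) by (metis dvdE mult_zero_left poly_mult)
  then have "constant (poly d)"
    using fundamental_theorem_of_algebra by blast
  then have "degree d = 0" by (simp add: constant_degree)
  with \<open>d \<noteq> 0\<close> show "is_unit d"
    by (simp add: is_unit_iff_degree)
qed

text \<open>By injectivity the factors split off so far do not vanish at a new root, so the cofactor
  does.\<close>

lemma prod_linear_dvd:
  fixes p :: "'a::idom poly"
  assumes "finite A" "inj_on f A" "\<And>i. i \<in> A \<Longrightarrow> poly p (f i) = 0"
  shows "(\<Prod>i\<in>A. [:- f i, 1:]) dvd p"
  using assms
proof (induction A rule: finite_induct)
  case (insert i A)
  then obtain c where c: "p = (\<Prod>i\<in>A. [:- f i, 1:]) * c"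
    by (auto elim: dvdE)
  have "poly (\<Prod>i\<in>A. [:- f i, 1:]) (f i) \<noteq> 0"
    using insert.hyps insert.prems(1) by (auto simp: poly_prod)
  moreover have "poly p (f i) = 0" by (rule insert.prems) simp
  ultimately have "poly c (f i) = 0" by (simp add: c)
  then have "[:- f i, 1:] dvd c" by (simp add: poly_eq_0_iff_dvd)
  then show ?case
    unfolding prod.insert[OF insert.hyps] c mult.commute[of _ c] by (rule mult_dvd_mono) simp
qed simp

section \<open>Roots of the cyclotomic polynomial\<close>

text \<open>An integer \<open>k\<close> allows differences of indices, as injectivity
  requires.\<close>

lemma cis_fraction_eq_1:
  fixes k :: int
  assumes "n > 0" "cis (2 * pi * k / real n) = 1"
  shows "int n dvd k"
proof -
  have "cos (2 * pi * k / real n) = 1"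
    using assms(2) by (metis cis.sel(1) one_complex.sel(1))
  then obtain m :: int where "2 * pi * k / real n = m * 2 * pi"
    by (auto simp: cos_one_2pi_int)
  then have "real_of_int k = real_of_int (m * int n)"
    using assms(1) by (simp add: field_simps)
  then have "k = m * int n" by linarith
  then show ?thesis by simp
qed

lemma cis_primitive_root:
  assumes "n > 0" "coprime j n" "cis (2 * pi * real j / real n) ^ i = 1"
  shows "n dvd i"
proof -
  have "cis (2 * pi * real_of_int (int (j * i)) / real n) = 1"
    using assms(3) by (simp add: DeMoivre mult_ac)
  then have "int n dvd int (j * i)"
    by (rule cis_fraction_eq_1[OF assms(1)])
  then show ?thesis
    using assms(2) by (simp add: coprime_dvd_mult_right_iff coprime_commute)
qed

lemma inj_on_cis_fraction:
  assumes "n > 0"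
  shows "inj_on (\<lambda>j. cis (2 * pi * real j / real n)) {1..n}"
proof (rule inj_onI)
  fix i j assume ij: "i \<in> {1..n}" "j \<in> {1..n}"
    and "cis (2 * pi * real i / real n) = cis (2 * pi * real j / real n)"
  then have "cis (2 * pi * real i / real n) / cis (2 * pi * real j / real n) = 1"
    by (simp add: cis_neq_zero)
  then have "cis (2 * pi * real_of_int (int i - int j) / real n) = 1"
    by (simp add: cis_divide diff_divide_distrib algebra_simps)
  from cis_fraction_eq_1[OF assms this] have "int n dvd int i - int j" .
  moreover have "\<bar>int i - int j\<bar> < int n" using ij by auto
  ultimately have "int i - int j = 0"
    using dvd_imp_le_int[of "int i - int j" "int n"] by auto
  then show "i = j" by simp
qed

definition cyclo_roots :: "nat \<Rightarrow> complex set" where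
  "cyclo_roots n = (\<lambda>j. cis (2 * pi * real j / real n)) ` {j. 1 \<le> j \<and> j \<le> n \<and> coprime j n}"

lemma cyclo_roots_nonempty: "n > 0 \<Longrightarrow> cyclo_roots n \<noteq> {}"
  by (auto simp: cyclo_roots_def intro!: exI[of _ 1])

text \<open>In a common fraction \<open>a / b\<close> for \<open>x - y\<close>, the denominator
  vanishes at no root of \<open>cyclo n\<close> and the numerator at all of them; as the roots are
  distinct, \<open>cyclo n\<close> divides \<open>a\<close>.\<close>

lemma ratfun_congI:
  assumes "n > 0" "evaluates_on (cyclo_roots n) x f" "evaluates_on (cyclo_roots n) y g"
    "\<And>z. z \<in> cyclo_roots n \<Longrightarrow> f z = g z"
  shows "ratfun_cong x y (cyclo n)"
proof -
  let ?J = "{j. 1 \<le> j \<and> j \<le> n \<and> coprime j n}"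
  let ?z = "\<lambda>j. cis (2 * pi * real j / real n)"
  obtain a b where ab: "b \<noteq> 0" "x - y = Fract a b"
    "\<And>z. z \<in> cyclo_roots n \<Longrightarrow> poly b z \<noteq> 0 \<and> f z - g z = poly a z / poly b z"
    using evaluates_on_diff[OF assms(2,3)] by (auto simp: evaluates_on_def)
  have b: "poly b (?z j) \<noteq> 0" and a: "poly a (?z j) = 0" if "j \<in> ?J" for j
    using ab(3)[of "?z j"] assms(4)[of "?z j"] that by (auto simp: cyclo_roots_def)
  have "coprime b (cyclo n)"
    using b ab(1) by (intro coprime_complex_polyI) (auto simp: cyclo_def poly_prod)
  moreover have "cyclo n dvd a"
    unfolding cyclo_def
  proof (rule prod_linear_dvd)
    show "inj_on ?z ?J"
      by (rule inj_on_subset[OF inj_on_cis_fraction[OF assms(1)]]) auto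
  qed (use a in auto)
  ultimately show ?thesis
    using ab unfolding ratfun_cong_def by blast
qed

text \<open>As \<open>n\<close> is odd, 4 cancels from \<open>n dvd 4 * i\<close>, and
  \<open>0 < i \<le> 2 * M < n\<close> excludes \<open>n dvd i\<close>.\<close>

lemma quarter_root_cyclo_root:
  assumes "n = 4 * M + 1" "z \<in> cyclo_roots n"
  shows "quarter_root z M"
proof -
  obtain j where j: "coprime j n" "z = cis (2 * pi * real j / real n)"
    using assms(2) by (auto simp: cyclo_roots_def)
  have n: "n > 0" using assms(1) by simp
  show ?thesis
  proof
    show "z ^ (4 * M + 1) = 1"
      using n by (simp only: j DeMoivre assms(1)[symmetric]) (simp add: cis_multiple_2pi)
    fix i assume i: "0 < i" "i \<le> 2 * M"
    show "z ^ (4 * i) \<noteq> 1"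
    proof
      assume "z ^ (4 * i) = 1"
      then have "n dvd 4 * i"
        using cis_primitive_root[OF n j(1)] by (simp add: j(2))
      moreover have "coprime n (2\<^sup>2)"
        by (simp only: coprime_power_right_iff coprime_right_2_iff_odd) (simp add: assms(1))
      ultimately have "n dvd i"
        by (simp add: coprime_dvd_mult_right_iff)
      with i assms(1) show False by (auto dest!: dvd_imp_le)
    qed
  qed
qed

theorem theorem5:
  fixes n :: nat
  assumes "n > 0" and "n mod 4 = 1"
  shows "ratfun_cong
    (\<Sum>k=0..(n - 1) div 2.
        (qpoch qvar (qvar^2) k)^2 * qpoch (qvar^2) (qvar^4) k
        / ((qpoch (qvar^2) (qvar^2) k)^2 * qpoch (qvar^4) (qvar^4) k) * (- qvar) ^ k)
    (if n mod 8 = 1 then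
       (qpoch qvar (qvar^4) ((n - 1) div 8) * qpoch (qvar^2) (qvar^4) ((n - 1) div 8))^2
         * qpoch (- qvar) qvar ((n - 1) div 2)
         / (qpoch (qvar^4) (qvar^4) ((n - 1) div 4))^2
         / qvar ^ ((n - 1)^2 div 4)
     else 0)
    (cyclo n)"
proof -
  define M where "M = n div 4"
  have n: "n = 4 * M + 1"
    using assms(2) by (simp add: M_def) presburger
  \<comment> \<open>For odd \<open>M\<close> the truncated quotient \<open>(n - 1) div 8\<close>
    occurs only in the branch not taken.\<close>
  have idx: "(n - 1) div 2 = 2 * M" "(n - 1) div 8 = M div 2" "(n - 1) div 4 = M"
    "n mod 8 = 1 \<longleftrightarrow> even M" "(n - 1)\<^sup>2 div 4 = 4 * M\<^sup>2"
    unfolding n by (auto simp: power_mult_distrib) presburger+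
  let ?Z = "cyclo_roots n"
  have Z: "?Z \<noteq> {}" by (rule cyclo_roots_nonempty) fact
  have root: "quarter_root z M" if "z \<in> ?Z" for z
    using quarter_root_cyclo_root[OF n that] .
  \<comment> \<open>These cover all \<open>k\<close> in the sum and discharge the side conditions of
    \<open>evaluates_on_divide\<close>.\<close>
  have ne4: "qpoch (z ^ 4) (z ^ 4) k \<noteq> 0" and ne2: "qpoch (z\<^sup>2) (z\<^sup>2) k \<noteq> 0"
    if "z \<in> ?Z" "k \<le> 2 * M" for z k
  proof -
    interpret quarter_root z M by (rule root) fact
    show "qpoch (z ^ 4) (z ^ 4) k \<noteq> 0"
      by (rule qpoch_base_nonzero) (use primitive that in \<open>auto simp flip: power_mult\<close>)
    show "qpoch (z\<^sup>2) (z\<^sup>2) k \<noteq> 0"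
    proof (rule qpoch_base_nonzero)
      fix i assume "0 < i" "i \<le> k"
      with that(2) have "z ^ (4 * i) \<noteq> 1"
        by (intro primitive) auto
      moreover have "z ^ (4 * i) = ((z\<^sup>2) ^ i)\<^sup>2"
        by (simp flip: power_mult)
      ultimately show "(z\<^sup>2) ^ i \<noteq> 1"
        by (metis one_power2)
    qed
  qed
  have ne0: "z \<noteq> 0" if "z \<in> ?Z" for z
  proof -
    interpret quarter_root z M by (rule root) fact
    show ?thesis by (rule q_nonzero)
  qed
  show ?thesis
    unfolding idx
  proof (rule ratfun_congI)
    show "evaluates_on ?Z (\<Sum>k=0..2 * M.
        (qpoch qvar (qvar^2) k)^2 * qpoch (qvar^2) (qvar^4) k
        / ((qpoch (qvar^2) (qvar^2) k)^2 * qpoch (qvar^4) (qvar^4) k) * (- qvar) ^ k)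
      (\<lambda>z. \<Sum>k=0..2 * M. (qpoch z (z^2) k)^2 * qpoch (z^2) (z^4) k
        / ((qpoch (z^2) (z^2) k)^2 * qpoch (z^4) (z^4) k) * (- z) ^ k)"
      by (intro evaluates_on_intros Z) (use ne2 ne4 in auto)
    show "evaluates_on ?Z (if even M then
       (qpoch qvar (qvar^4) (M div 2) * qpoch (qvar^2) (qvar^4) (M div 2))^2
         * qpoch (- qvar) qvar (2 * M) / (qpoch (qvar^4) (qvar^4) M)^2 / qvar ^ (4 * M\<^sup>2)
       else 0)
      (\<lambda>z. if even M then
       (qpoch z (z^4) (M div 2) * qpoch (z^2) (z^4) (M div 2))^2
         * qpoch (- z) z (2 * M) / (qpoch (z^4) (z^4) M)^2 / z ^ (4 * M\<^sup>2)
       else 0)"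
    proof (cases "even M")
      case True
      show ?thesis
        unfolding if_P[OF True]
        by (intro evaluates_on_intros Z) (use ne4 ne0 in auto)
    next
      case False
      then show ?thesis by (simp add: evaluates_on_0)
    qed
    fix z assume "z \<in> ?Z"
    then interpret quarter_root z M by (rule root)
    show "(\<Sum>k=0..2 * M. (qpoch z (z^2) k)^2 * qpoch (z^2) (z^4) k
        / ((qpoch (z^2) (z^2) k)^2 * qpoch (z^4) (z^4) k) * (- z) ^ k)
      = (if even M then
       (qpoch z (z^4) (M div 2) * qpoch (z^2) (z^4) (M div 2))^2
         * qpoch (- z) z (2 * M) / (qpoch (z^4) (z^4) M)^2 / z ^ (4 * M\<^sup>2)
       else 0)"
      using sum_jcoeff unfolding jcoeff_def atLeast0AtMost .
  qed fact
qed

end
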